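(* Let $H$ and $K$ be strongly Archimedean, cancellative, duo monoids, at least one of which is reduced. Then every semigroup isomorphism $f\colon\mathcal{P}(H)\to\mathcal{P}(K)$ restricts to an isomorphism from $\mathfrak{I}(H)$ to $\mathfrak{I}(K)$ (that is, $f[\mathfrak{I}(H)]=\mathfrak{I}(K)$). In particular, if $H$ and $K$ are globally isomorphic (i.e. $\mathcal{P}(H)$ is isomorphic to $\mathcal{P}(K)$), then $H$ and $K$ are isomorphic.
   Context: Monoids are written multiplicatively; $H^\times$ is the group of units of a monoid $H$, and $H$ is reduced if $H^\times=\{1_H\}$. For subsets $X,Y$ of $H$, $XY:=\{xy : x\in X,\ y\in Y\}$, and braces of singletons are omitted in such products (e.g. $HaH = H\{a\}H$). A monoid $H$ is: cancellative if $ax\ne ay$ and $xa\neq ya$ for all $a,x,y\in H$ with $x\ne y$; duo if $aH=Ha$ for every $a\in H$; strongly Archimedean if, for every $a\in H$, there is an integer $k\ge 1$ such that $HaH$ contains every product $b_1\cdots b_k$ of $k$ non-units $b_1,\dots,b_k\in H$. $\mathcal{P}(H)$ is the semigroup of all non-empty subsets of $H$ under setwise multiplication. An ideal of $H$ is a non-empty set $I\subseteq H$ with $IH\subseteq I$ and $HI\subseteq I$; the ideals of $H$ form a subsemigroup $\mathfrak{I}(H)$ of $\mathcal{P}(H)$. "Isomorphism" means semigroup isomorphism. *)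

theory Defs
  imports "HOL-Algebra.Divisibility" "HOL-Algebra.Coset"
begin

definition reduced_monoid :: "('a, 'b) monoid_scheme \<Rightarrow> bool" where
  "reduced_monoid H \<longleftrightarrow> Units H = {\<one>\<^bsub>H\<^esub>}"

definition duo_monoid :: "('a, 'b) monoid_scheme \<Rightarrow> bool" where
  "duo_monoid H \<longleftrightarrow> (\<forall>a\<in>carrier H. a <#\<^bsub>H\<^esub> carrier H = carrier H #>\<^bsub>H\<^esub> a)"

definition strongly_archimedean :: "('a, 'b) monoid_scheme \<Rightarrow> bool" where
  "strongly_archimedean H \<longleftrightarrow>
    (\<forall>a\<in>carrier H. \<exists>k::nat. k \<ge> 1 \<and>
      (\<forall>bs. length bs = k \<and> set bs \<subseteq> carrier H - Units H \<longrightarrow>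
        foldr (\<otimes>\<^bsub>H\<^esub>) bs \<one>\<^bsub>H\<^esub> \<in> carrier H <#>\<^bsub>H\<^esub> {a} <#>\<^bsub>H\<^esub> carrier H))"

definition monoid_ideal :: "'a set \<Rightarrow> ('a, 'b) monoid_scheme \<Rightarrow> bool" where
  "monoid_ideal I H \<longleftrightarrow>
    I \<noteq> {} \<and> I \<subseteq> carrier H \<and> I <#>\<^bsub>H\<^esub> carrier H \<subseteq> I \<and> carrier H <#>\<^bsub>H\<^esub> I \<subseteq> I"

(* The next two structures are meant as semigroups. The record type asks for a unit, so each gets
   its actual identity element; hom, iso and is_iso never refer to that field, so they are the
   semigroup notions. *)

definition power_semigroup :: "('a, 'b) monoid_scheme \<Rightarrow> 'a set monoid" where
  "power_semigroup H =
    \<lparr>carrier = {X. X \<subseteq> carrier H \<and> X \<noteq> {}}, monoid.mult = set_mult H, one = {\<one>\<^bsub>H\<^esub>}\<rparr>"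

definition ideal_semigroup :: "('a, 'b) monoid_scheme \<Rightarrow> 'a set monoid" where
  "ideal_semigroup H =
    \<lparr>carrier = {I. monoid_ideal I H}, monoid.mult = set_mult H, one = carrier H\<rparr>"

lemma set_mult_assoc_monoid:
  assumes "monoid H" "X \<subseteq> carrier H" "Y \<subseteq> carrier H" "Z \<subseteq> carrier H"
  shows "(X <#>\<^bsub>H\<^esub> Y) <#>\<^bsub>H\<^esub> Z = X <#>\<^bsub>H\<^esub> (Y <#>\<^bsub>H\<^esub> Z)"
proof -
  have "\<And>x y z. x \<in> X \<Longrightarrow> y \<in> Y \<Longrightarrow> z \<in> Z \<Longrightarrow>
      (x \<otimes>\<^bsub>H\<^esub> y) \<otimes>\<^bsub>H\<^esub> z = x \<otimes>\<^bsub>H\<^esub> (y \<otimes>\<^bsub>H\<^esub> z)"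
    using assms by (meson monoid.m_assoc subsetD)
  then show ?thesis
    unfolding set_mult_def by auto
qed

lemma monoid_power_semigroup:
  assumes "monoid H"
  shows "monoid (power_semigroup H)"
proof -
  interpret monoid H by fact
  show ?thesis
  proof (rule monoidI)
    fix X Y assume "X \<in> carrier (power_semigroup H)" "Y \<in> carrier (power_semigroup H)"
    then show "X \<otimes>\<^bsub>power_semigroup H\<^esub> Y \<in> carrier (power_semigroup H)"
      unfolding power_semigroup_def set_mult_def by auto
  next
    fix X assume "X \<in> carrier (power_semigroup H)"
    then have X: "X \<subseteq> carrier H" by (simp add: power_semigroup_def)
    then have "\<And>x. x \<in> X \<Longrightarrow> \<one>\<^bsub>H\<^esub> \<otimes>\<^bsub>H\<^esub> x = x" "\<And>x. x \<in> X \<Longrightarrow> x \<otimes>\<^bsub>H\<^esub> \<one>\<^bsub>H\<^esub> = x" by auto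
    then show "\<one>\<^bsub>power_semigroup H\<^esub> \<otimes>\<^bsub>power_semigroup H\<^esub> X = X"
      and "X \<otimes>\<^bsub>power_semigroup H\<^esub> \<one>\<^bsub>power_semigroup H\<^esub> = X"
      by (auto simp: power_semigroup_def set_mult_def)
  qed (simp_all add: power_semigroup_def set_mult_assoc_monoid[OF assms])
qed

lemma set_mult_mono:
  "X \<subseteq> X' \<Longrightarrow> Y \<subseteq> Y' \<Longrightarrow> X <#>\<^bsub>H\<^esub> Y \<subseteq> X' <#>\<^bsub>H\<^esub> Y'"
  unfolding set_mult_def by blast

lemma monoid_ideal_semigroup:
  assumes "monoid H"
  shows "monoid (ideal_semigroup H)"
proof -
  interpret monoid H by fact
  note assoc = set_mult_assoc_monoid[OF assms]
  show ?thesis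
  proof (rule monoidI)
    fix I J assume "I \<in> carrier (ideal_semigroup H)" "J \<in> carrier (ideal_semigroup H)"
    then have I: "monoid_ideal I H" and J: "monoid_ideal J H"
      by (auto simp: ideal_semigroup_def)
    have "(I <#>\<^bsub>H\<^esub> J) <#>\<^bsub>H\<^esub> carrier H = I <#>\<^bsub>H\<^esub> (J <#>\<^bsub>H\<^esub> carrier H)"
      using I J by (intro assoc) (auto simp: monoid_ideal_def)
    also have "\<dots> \<subseteq> I <#>\<^bsub>H\<^esub> J"
      using J by (intro set_mult_mono) (auto simp: monoid_ideal_def)
    finally have "(I <#>\<^bsub>H\<^esub> J) <#>\<^bsub>H\<^esub> carrier H \<subseteq> I <#>\<^bsub>H\<^esub> J" .
    moreover have "carrier H <#>\<^bsub>H\<^esub> (I <#>\<^bsub>H\<^esub> J) \<subseteq> I <#>\<^bsub>H\<^esub> J"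
    proof -
      have "carrier H <#>\<^bsub>H\<^esub> (I <#>\<^bsub>H\<^esub> J) = (carrier H <#>\<^bsub>H\<^esub> I) <#>\<^bsub>H\<^esub> J"
        using I J by (intro assoc[symmetric]) (auto simp: monoid_ideal_def)
      also have "\<dots> \<subseteq> I <#>\<^bsub>H\<^esub> J"
        using I by (intro set_mult_mono) (auto simp: monoid_ideal_def)
      finally show ?thesis .
    qed
    moreover have "I <#>\<^bsub>H\<^esub> J \<noteq> {}" "I <#>\<^bsub>H\<^esub> J \<subseteq> carrier H"
      using I J by (auto simp: monoid_ideal_def set_mult_def)
    ultimately show "I \<otimes>\<^bsub>ideal_semigroup H\<^esub> J \<in> carrier (ideal_semigroup H)"
      by (simp add: ideal_semigroup_def monoid_ideal_def)
  next
    fix I assume "I \<in> carrier (ideal_semigroup H)"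
    then have I: "monoid_ideal I H" by (simp add: ideal_semigroup_def)
    have "x \<in> I <#>\<^bsub>H\<^esub> carrier H" "x \<in> carrier H <#>\<^bsub>H\<^esub> I" if "x \<in> I" for x
    proof -
      have x: "x \<in> carrier H"
        using I that unfolding monoid_ideal_def by blast
      show "x \<in> I <#>\<^bsub>H\<^esub> carrier H" "x \<in> carrier H <#>\<^bsub>H\<^esub> I"
        unfolding set_mult_def UN_iff singleton_iff
        using that r_one[OF x] l_one[OF x] one_closed by metis+
    qed
    then have "I \<subseteq> I <#>\<^bsub>H\<^esub> carrier H" "I \<subseteq> carrier H <#>\<^bsub>H\<^esub> I"
      by blast+
    then show "\<one>\<^bsub>ideal_semigroup H\<^esub> \<otimes>\<^bsub>ideal_semigroup H\<^esub> I = I"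
      and "I \<otimes>\<^bsub>ideal_semigroup H\<^esub> \<one>\<^bsub>ideal_semigroup H\<^esub> = I"
      using I by (simp_all add: ideal_semigroup_def monoid_ideal_def subset_antisym)
  next
    show "\<one>\<^bsub>ideal_semigroup H\<^esub> \<in> carrier (ideal_semigroup H)"
      by (auto simp: ideal_semigroup_def monoid_ideal_def set_mult_def)
  qed (simp add: ideal_semigroup_def monoid_ideal_def set_mult_assoc_monoid[OF assms])
qed

end

theory Submission
  imports Defs
begin

text \<open>
  Isomorphisms preserve units, so both monoids are reduced. In a reduced, cancellative, duo, strongly
  Archimedean monoid every idempotent of the power semigroup contains the identity: otherwise it
  consists of non-units, and an element \<open>a\<close> of it, being a product of arbitrarily many of its
  members, would lie in \<open>H a\<^sup>2 H\<close> and thus be a unit. Hence \<open>H\<close> is the zero of the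
  idempotents of \<open>\<P>(H)\<close>, so an isomorphism sends \<open>H\<close> to \<open>K\<close>; and in a duo monoid the ideals are
  the non-empty sets \<open>X\<close> with \<open>X H = X\<close>.

  For the second claim, the left-cancellable elements of \<open>\<P>(H)\<close> are exactly the singletons: if
  \<open>a \<noteq> b\<close> both lie in \<open>A\<close>, then \<open>A H = A (H \<setminus> {a b})\<close>, because \<open>A a b\<close> can be rewritten using a
  different left factor from \<open>A\<close>.
\<close>

section \<open>Set products and the invariance of reducedness\<close>

lemma mem_set_mult_iff:
  "z \<in> X <#>\<^bsub>H\<^esub> Y \<longleftrightarrow> (\<exists>x\<in>X. \<exists>y\<in>Y. z = x \<otimes>\<^bsub>H\<^esub> y)"
  by (auto simp: set_mult_def)

lemma power_semigroup_simps [simp]: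
  "X \<in> carrier (power_semigroup H) \<longleftrightarrow> X \<subseteq> carrier H \<and> X \<noteq> {}"
  "X \<otimes>\<^bsub>power_semigroup H\<^esub> Y = X <#>\<^bsub>H\<^esub> Y"
  "\<one>\<^bsub>power_semigroup H\<^esub> = {\<one>\<^bsub>H\<^esub>}"
  by (auto simp: power_semigroup_def)

lemma ideal_semigroup_simps [simp]:
  "I \<in> carrier (ideal_semigroup H) \<longleftrightarrow> monoid_ideal I H"
  "I \<otimes>\<^bsub>ideal_semigroup H\<^esub> J = I <#>\<^bsub>H\<^esub> J"
  by (auto simp: ideal_semigroup_def)

text \<open>Members of \<open>hom\<close> need not respect units. Surjectivity supplies some
  \<open>e\<close> mapped to the unit of \<open>G'\<close>, and multiplying \<open>f \<one>\<close>
  by \<open>f e\<close> can be read both as \<open>f \<one>\<close> and as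
  \<open>f e\<close>.\<close>

lemma (in monoid) iso_one:
  assumes "monoid G'" "f \<in> iso G G'"
  shows "f \<one> = \<one>\<^bsub>G'\<^esub>"
proof -
  interpret G': monoid G' by fact
  have f: "f \<in> hom G G'" "f ` carrier G = carrier G'"
    using assms(2) by (auto simp: iso_iff)
  obtain e where e: "e \<in> carrier G" "f e = \<one>\<^bsub>G'\<^esub>"
    using f(2) by (metis G'.one_closed imageE)
  have "f \<one> = f \<one> \<otimes>\<^bsub>G'\<^esub> f e"
    using e f(1) by (simp add: hom_in_carrier)
  also have "\<dots> = f (\<one> \<otimes> e)"
    by (rule hom_mult[OF f(1) one_closed e(1), symmetric])
  finally show ?thesis
    using e by simp
qed

lemma (in monoid) reduced_monoid_iso_iff:
  assumes "monoid G'" "f \<in> iso G G'"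
  shows "reduced_monoid G' \<longleftrightarrow> reduced_monoid G"
proof -
  have hom: "f \<in> hom G G'" and im: "carrier G' = f ` carrier G" and inj: "inj_on f (carrier G)"
    using assms(2) by (auto simp: iso_iff)
  have one: "\<one>\<^bsub>G'\<^esub> = f \<one>"
    using iso_one[OF assms] by simp
  \<comment> \<open>Quantifiers over \<open>carrier G'\<close> become quantifiers over
    \<open>carrier G\<close> by surjectivity, and equations between images pull back by
    injectivity.\<close>
  have Units_iff: "f u \<in> Units G' \<longleftrightarrow> u \<in> Units G" if "u \<in> carrier G" for u
    unfolding Units_def im one
    using that by (simp add: inj_on_eq_iff[OF inj] inj_on_image_mem_iff[OF inj] flip: hom_mult[OF hom])
  have "Units G' = f ` Units G"
  proof
    show "Units G' \<subseteq> f ` Units G"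
    proof
      fix v assume v: "v \<in> Units G'"
      then obtain u where "u \<in> carrier G" "v = f u"
        using im by (auto simp: Units_def)
      then show "v \<in> f ` Units G"
        using v Units_iff by blast
    qed
    show "f ` Units G \<subseteq> Units G'"
      using Units_iff by blast
  qed
  moreover have "f ` Units G = f ` {\<one>} \<longleftrightarrow> Units G = {\<one>}"
    using inj by (rule inj_on_image_eq_iff) auto
  ultimately show ?thesis
    by (simp add: reduced_monoid_def one)
qed

text \<open>If X and Y are mutually inverse sets, any element of X is inverse to any element of Y,
  so a unit of the power semigroup consists of units of \<open>G\<close>. Conversely, each unit of
  \<open>G\<close> gives a singleton unit. This makes reducedness visible in the power
  semigroup.\<close>

lemma (in monoid) reduced_power_semigroup_iff:
  "reduced_monoid (power_semigroup G) \<longleftrightarrow> reduced_monoid G"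
proof
  interpret P: monoid "power_semigroup G"
    by (rule monoid_power_semigroup) (rule monoid_axioms)
  show "reduced_monoid G" if P: "reduced_monoid (power_semigroup G)"
  proof -
    have "u = \<one>" if "u \<in> Units G" for u
    proof -
      have "{u} \<in> Units (power_semigroup G)"
        using that by (auto simp: Units_def set_mult_def)
      then show ?thesis
        using P by (simp add: reduced_monoid_def)
    qed
    then show ?thesis
      by (auto simp: reduced_monoid_def)
  qed
  show "reduced_monoid (power_semigroup G)" if G: "reduced_monoid G"
  proof -
    have "X = {\<one>}" if XU: "X \<in> Units (power_semigroup G)" for X
    proof -
      obtain Y where X: "X \<subseteq> carrier G" "X \<noteq> {}" and Y: "Y \<subseteq> carrier G" "Y \<noteq> {}"
        and XY: "X <#> Y = {\<one>}" "Y <#> X = {\<one>}"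
        using XU unfolding Units_def power_semigroup_simps Bex_def mem_Collect_eq by blast
      obtain y where y: "y \<in> Y"
        using Y(2) by blast
      have "x \<in> Units G" if "x \<in> X" for x
      proof -
        have "x \<otimes> y \<in> X <#> Y" "y \<otimes> x \<in> Y <#> X"
          using that y by (auto simp: mem_set_mult_iff)
        then show ?thesis
          using XY that y X(1) Y(1) by (auto simp: Units_def)
      qed
      then show ?thesis
        using G X(2) by (auto simp: reduced_monoid_def)
    qed
    then show ?thesis
      using P.Units_one_closed unfolding reduced_monoid_def power_semigroup_simps(3) by blast
  qed
qed

text \<open>Reducedness is given on one side only, while the argument on idempotents is applied in
  both monoids.\<close>

lemma reduced_monoid_power_iso:
  assumes "monoid H" "monoid K" "f \<in> iso (power_semigroup H) (power_semigroup K)"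
  shows "reduced_monoid H \<longleftrightarrow> reduced_monoid K"
proof -
  interpret PH: monoid "power_semigroup H"
    using assms(1) by (rule monoid_power_semigroup)
  interpret PK: monoid "power_semigroup K"
    using assms(2) by (rule monoid_power_semigroup)
  show ?thesis
    using PH.reduced_monoid_iso_iff[OF PK.monoid_axioms assms(3)]
    by (simp add: monoid.reduced_power_semigroup_iff assms(1,2))
qed

section \<open>Idempotent sets and the image of the whole monoid\<close>

lemma duo_monoidD:
  assumes "duo_monoid G" "x \<in> carrier G" "y \<in> carrier G"
  shows "\<exists>z\<in>carrier G. y \<otimes>\<^bsub>G\<^esub> x = x \<otimes>\<^bsub>G\<^esub> z"
proof -
  have "y \<otimes>\<^bsub>G\<^esub> x \<in> carrier G #>\<^bsub>G\<^esub> x"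
    using assms(3) by (auto simp: r_coset_def)
  also have "\<dots> = x <#\<^bsub>G\<^esub> carrier G"
    using assms(1,2) by (simp add: duo_monoid_def)
  finally show ?thesis
    by (auto simp: l_coset_def)
qed

text \<open>Cancel \<open>y\<close> on the right in (y x) y = y (x y) = y.\<close>

lemma (in monoid_cancel) right_inverse_is_left_inverse:
  assumes "x \<in> carrier G" "y \<in> carrier G" "x \<otimes> y = \<one>"
  shows "y \<otimes> x = \<one>"
proof (rule r_cancel)
  show "y \<otimes> x \<otimes> y = \<one> \<otimes> y"
    using assms by (simp add: m_assoc)
qed (use assms in simp_all)

text \<open>Since X = X X, the last factor can be split again and again inside X. The length is a
  successor because the empty product is the identity, which need not lie in X.\<close>

lemma (in monoid) idempotent_set_factorization:
  assumes "X \<subseteq> carrier G" "X <#> X = X" "x \<in> X"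
  shows "\<exists>bs. length bs = Suc k \<and> set bs \<subseteq> X \<and> foldr (\<otimes>) bs \<one> = x"
  using assms(3)
proof (induction k arbitrary: x)
  case 0
  then show ?case
    using assms(1) by (intro exI[of _ "[x]"]) auto
next
  case (Suc k)
  obtain y z where yz: "y \<in> X" "z \<in> X" "x = y \<otimes> z"
    using assms(2) Suc.prems by (metis mem_set_mult_iff)
  obtain bs where "length bs = Suc k" "set bs \<subseteq> X" "foldr (\<otimes>) bs \<one> = z"
    using Suc.IH[OF yz(2)] by blast
  then show ?case
    using yz by (intro exI[of _ "y # bs"]) auto
qed

lemma (in monoid_cancel) one_in_idempotent_set:
  assumes "duo_monoid G" "strongly_archimedean G" "reduced_monoid G"
    and X: "X \<subseteq> carrier G" "X \<noteq> {}" "X <#> X = X"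
  shows "\<one> \<in> X"
proof (rule ccontr)
  assume no_one: "\<one> \<notin> X"
  obtain a where a: "a \<in> X" "a \<in> carrier G"
    using X by blast
  \<comment> \<open>The Archimedean property is used for the square of \<open>a\<close>: membership
    of \<open>a\<close> in H a H would be trivial.\<close>
  have "\<exists>k\<ge>1. \<forall>bs. length bs = k \<and> set bs \<subseteq> carrier G - Units G \<longrightarrow>
      foldr (\<otimes>) bs \<one> \<in> carrier G <#> {a \<otimes> a} <#> carrier G"
    using assms(2) a(2) by (simp add: strongly_archimedean_def)
  then obtain k where k: "k \<ge> 1" and arch: "\<And>bs. length bs = k \<Longrightarrow>
      set bs \<subseteq> carrier G - Units G \<Longrightarrow> foldr (\<otimes>) bs \<one> \<in> carrier G <#> {a \<otimes> a} <#> carrier G"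
    by blast
  \<comment> \<open>The factorization has length \<open>Suc (k - 1)\<close>, which is
    \<open>k\<close> because \<open>k \<ge> 1\<close>.\<close>
  obtain bs where bs: "length bs = k" "set bs \<subseteq> X" "foldr (\<otimes>) bs \<one> = a"
    using idempotent_set_factorization[OF X(1,3) a(1), of "k - 1"] k by auto
  have "X \<subseteq> carrier G - Units G"
    using X(1) no_one assms(3) by (auto simp: reduced_monoid_def)
  then have "a \<in> carrier G <#> {a \<otimes> a} <#> carrier G"
    using arch[of bs] bs by auto
  then obtain h h' where h: "h \<in> carrier G" "h' \<in> carrier G" "a = h \<otimes> (a \<otimes> a) \<otimes> h'"
    by (auto simp: mem_set_mult_iff)
  \<comment> \<open>Moving \<open>h\<close> past the first \<open>a\<close> brings that
    \<open>a\<close> to the front, where it cancels against the left-hand side.\<close>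
  obtain g where g: "g \<in> carrier G" "h \<otimes> a = a \<otimes> g"
    using duo_monoidD[OF assms(1) a(2) h(1)] by blast
  have "a \<otimes> \<one> = h \<otimes> a \<otimes> a \<otimes> h'"
    using a h by (simp add: m_assoc)
  also have "\<dots> = a \<otimes> (g \<otimes> a \<otimes> h')"
    using a g h by (simp add: m_assoc)
  finally have "\<one> = g \<otimes> a \<otimes> h'"
    by (rule l_cancel) (use a g h in auto)
  then have "g \<otimes> a \<otimes> h' = \<one>" ..
  \<comment> \<open>Here \<open>a\<close> is the middle factor of a product equal to the identity.
    Two cyclic rotations make \<open>h' \<otimes> g\<close> a two-sided inverse of it.\<close>
  then have "h' \<otimes> (g \<otimes> a) = \<one>"
    by (rule right_inverse_is_left_inverse[rotated 2]) (use a g h in auto)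
  then have left: "(h' \<otimes> g) \<otimes> a = \<one>"
    using a g h by (simp add: m_assoc)
  then have "a \<otimes> (h' \<otimes> g) = \<one>"
    by (rule right_inverse_is_left_inverse[rotated 2]) (use a g h in auto)
  with left have "a \<in> Units G"
    using a g h unfolding Units_def by blast
  then show False
    using a(1) no_one assms(3) by (simp add: reduced_monoid_def)
qed

lemma (in monoid) set_mult_carrier_eq:
  assumes "X \<subseteq> carrier G" "\<one> \<in> X"
  shows "X <#> carrier G = carrier G" "carrier G <#> X = carrier G"
proof -
  have "z \<in> X <#> carrier G" "z \<in> carrier G <#> X" if "z \<in> carrier G" for z
    using assms(2) that l_one[OF that] r_one[OF that] unfolding mem_set_mult_iff by metis+
  moreover have "X <#> carrier G \<subseteq> carrier G" "carrier G <#> X \<subseteq> carrier G"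
    using assms(1) by (auto simp: set_mult_def)
  ultimately show "X <#> carrier G = carrier G" "carrier G <#> X = carrier G"
    by blast+
qed

text \<open>Let E be the preimage of K. Injectivity makes E idempotent, so it contains the identity
  and H E = H; applying \<open>f\<close> gives f(H) K = f(H). But f(H) is idempotent too and
  contains the identity, so f(H) K = K.\<close>

lemma power_iso_carrier:
  assumes H: "monoid_cancel H" "duo_monoid H" "strongly_archimedean H" "reduced_monoid H"
    and K: "monoid_cancel K" "duo_monoid K" "strongly_archimedean K" "reduced_monoid K"
    and f: "f \<in> iso (power_semigroup H) (power_semigroup K)"
  shows "f (carrier H) = carrier K"
proof -
  interpret H: monoid_cancel H by fact
  interpret K: monoid_cancel K by fact
  have fhom: "f \<in> hom (power_semigroup H) (power_semigroup K)"
    and fim: "f ` carrier (power_semigroup H) = carrier (power_semigroup K)"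
    and finj: "inj_on f (carrier (power_semigroup H))"
    using f by (auto simp: iso_iff)
  have HH: "carrier H <#>\<^bsub>H\<^esub> carrier H = carrier H"
    and KK: "carrier K <#>\<^bsub>K\<^esub> carrier K = carrier K"
    by (simp_all add: H.set_mult_carrier_eq K.set_mult_carrier_eq)
  have PH: "carrier H \<in> carrier (power_semigroup H)"
    and PK: "carrier K \<in> carrier (power_semigroup K)"
    by auto
  obtain E where E: "E \<in> carrier (power_semigroup H)" "f E = carrier K"
    using PK fim by (metis imageE)
  have "f (E <#>\<^bsub>H\<^esub> E) = f E"
    using hom_mult[OF fhom E(1) E(1)] E(2) KK by simp
  moreover have "E <#>\<^bsub>H\<^esub> E \<in> carrier (power_semigroup H)"
    using E(1) monoid.m_closed[OF monoid_power_semigroup[OF H.monoid_axioms] E(1) E(1)] by simp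
  ultimately have EE: "E <#>\<^bsub>H\<^esub> E = E"
    using finj E(1) by (meson inj_onD)
  have "\<one>\<^bsub>H\<^esub> \<in> E"
    using H.one_in_idempotent_set[OF H(2-4)] E(1) EE by simp
  then have "carrier H <#>\<^bsub>H\<^esub> E = carrier H"
    using E(1) by (simp add: H.set_mult_carrier_eq)
  then have eq: "f (carrier H) = f (carrier H) <#>\<^bsub>K\<^esub> carrier K"
    using hom_mult[OF fhom PH E(1)] E(2) by simp
  have fH: "f (carrier H) \<in> carrier (power_semigroup K)"
    using fhom PH by (rule hom_in_carrier)
  have "f (carrier H) <#>\<^bsub>K\<^esub> f (carrier H) = f (carrier H)"
    using hom_mult[OF fhom PH PH] HH by simp
  then have "\<one>\<^bsub>K\<^esub> \<in> f (carrier H)"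
    using K.one_in_idempotent_set[OF K(2-4)] fH by simp
  then show ?thesis
    using eq fH by (simp add: K.set_mult_carrier_eq)
qed

section \<open>Ideals of duo monoids\<close>

lemma (in monoid) duo_set_mult_carrier_commute:
  assumes "duo_monoid G" "X \<subseteq> carrier G"
  shows "carrier G <#> X = X <#> carrier G"
proof -
  have "carrier G <#> X = (\<Union>x\<in>X. carrier G #> x)"
    by (auto simp: set_mult_def r_coset_def)
  also have "\<dots> = (\<Union>x\<in>X. x <#\<^bsub>G\<^esub> carrier G)"
    using assms by (auto simp: duo_monoid_def)
  also have "\<dots> = X <#> carrier G"
    by (auto simp: set_mult_def l_coset_def)
  finally show ?thesis .
qed

text \<open>The identity makes right absorption an equality, and duo makes left absorption the same
  condition. Being an ideal is thus an equation in the power semigroup with \<open>carrier G\<close>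
  as a parameter, so it transfers along any isomorphism that respects this parameter.\<close>

lemma (in monoid) duo_monoid_ideal_iff:
  assumes "duo_monoid G"
  shows "monoid_ideal I G \<longleftrightarrow> I \<in> carrier (power_semigroup G) \<and> I <#> carrier G = I"
proof -
  have "I \<subseteq> I <#> carrier G" if "I \<subseteq> carrier G"
    using that by (force simp: mem_set_mult_iff)
  then show ?thesis
    using duo_set_mult_carrier_commute[OF assms, of I] by (auto simp: monoid_ideal_def)
qed

lemma power_iso_imp_ideal_iso:
  assumes H: "monoid H" "duo_monoid H" and K: "monoid K" "duo_monoid K"
    and f: "f \<in> iso (power_semigroup H) (power_semigroup K)"
    and f_carrier: "f (carrier H) = carrier K"
  shows "f \<in> iso (ideal_semigroup H) (ideal_semigroup K)"
proof -
  interpret H: monoid H by fact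
  interpret K: monoid K by fact
  interpret PH: monoid "power_semigroup H"
    by (rule monoid_power_semigroup) fact
  have fhom: "f \<in> hom (power_semigroup H) (power_semigroup K)"
    and fim: "f ` carrier (power_semigroup H) = carrier (power_semigroup K)"
    and finj: "inj_on f (carrier (power_semigroup H))"
    using f by (auto simp: iso_iff)
  have PH: "carrier H \<in> carrier (power_semigroup H)"
    by auto
  \<comment> \<open>By f(X) K = f(X H), the equation X H = X passes to the image, and injectivity of
    \<open>f\<close> brings it back.\<close>
  have ideal_iff: "f X \<in> carrier (ideal_semigroup K) \<longleftrightarrow> X \<in> carrier (ideal_semigroup H)"
    if X: "X \<in> carrier (power_semigroup H)" for X
  proof -
    have "f X <#>\<^bsub>K\<^esub> carrier K = f (X <#>\<^bsub>H\<^esub> carrier H)"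
      using hom_mult[OF fhom X PH] f_carrier by simp
    moreover have "X <#>\<^bsub>H\<^esub> carrier H \<in> carrier (power_semigroup H)"
      using PH.m_closed[OF X PH] by simp
    ultimately have "f X <#>\<^bsub>K\<^esub> carrier K = f X \<longleftrightarrow> X <#>\<^bsub>H\<^esub> carrier H = X"
      using finj X by (metis inj_onD)
    then show ?thesis
      using X hom_in_carrier[OF fhom X]
      unfolding ideal_semigroup_simps H.duo_monoid_ideal_iff[OF H(2)] K.duo_monoid_ideal_iff[OF K(2)] by blast
  qed
  have subH: "carrier (ideal_semigroup H) \<subseteq> carrier (power_semigroup H)"
    and subK: "carrier (ideal_semigroup K) \<subseteq> carrier (power_semigroup K)"
    by (auto simp: monoid_ideal_def)
  show ?thesis
    unfolding iso_iff
  proof (intro conjI)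
    show "f \<in> hom (ideal_semigroup H) (ideal_semigroup K)"
    proof (rule homI)
      fix X Y assume XY: "X \<in> carrier (ideal_semigroup H)" "Y \<in> carrier (ideal_semigroup H)"
      show "f X \<in> carrier (ideal_semigroup K)"
        using XY(1) subH ideal_iff by blast
      have "X \<in> carrier (power_semigroup H)" "Y \<in> carrier (power_semigroup H)"
        using XY subH by blast+
      from hom_mult[OF fhom this]
      show "f (X \<otimes>\<^bsub>ideal_semigroup H\<^esub> Y) = f X \<otimes>\<^bsub>ideal_semigroup K\<^esub> f Y"
        by simp
    qed
    show "inj_on f (carrier (ideal_semigroup H))"
      using finj subH by (rule inj_on_subset)
    show "f ` carrier (ideal_semigroup H) = carrier (ideal_semigroup K)"
    proof
      show "f ` carrier (ideal_semigroup H) \<subseteq> carrier (ideal_semigroup K)"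
        using ideal_iff subH by blast
      show "carrier (ideal_semigroup K) \<subseteq> f ` carrier (ideal_semigroup H)"
      proof
        fix J assume J: "J \<in> carrier (ideal_semigroup K)"
        then have "J \<in> f ` carrier (power_semigroup H)"
          using subK fim by blast
        then show "J \<in> f ` carrier (ideal_semigroup H)"
          using J ideal_iff by blast
      qed
    qed
  qed
qed

section \<open>Left-cancellable sets and the passage from sets to elements\<close>

definition left_cancellable :: "('a, 'b) monoid_scheme \<Rightarrow> 'a \<Rightarrow> bool" where
  "left_cancellable G a \<longleftrightarrow>
    (\<forall>x\<in>carrier G. \<forall>y\<in>carrier G. a \<otimes>\<^bsub>G\<^esub> x = a \<otimes>\<^bsub>G\<^esub> y \<longrightarrow> x = y)"

lemma left_cancellable_iso_iff:
  assumes "monoid G" "f \<in> iso G G'" "a \<in> carrier G"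
  shows "left_cancellable G' (f a) \<longleftrightarrow> left_cancellable G a"
proof -
  interpret monoid G by fact
  have hom: "f \<in> hom G G'" and im: "carrier G' = f ` carrier G" and inj: "inj_on f (carrier G)"
    using assms(2) by (auto simp: iso_iff)
  show ?thesis
    unfolding left_cancellable_def im
    using assms(3) inj by (simp add: inj_on_eq_iff flip: hom_mult[OF hom])
qed

lemma (in monoid_cancel) left_cancellable_power_semigroup_iff:
  assumes duo: "duo_monoid G" and A: "A \<in> carrier (power_semigroup G)"
  shows "left_cancellable (power_semigroup G) A \<longleftrightarrow> (\<exists>a\<in>carrier G. A = {a})"
proof
  assume "\<exists>a\<in>carrier G. A = {a}"
  then obtain a where a: "a \<in> carrier G" "A = {a}"
    by blast
  have "{a} <#> X = (\<lambda>x. a \<otimes> x) ` X" for X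
    by (auto simp: set_mult_def)
  moreover have "inj_on (\<lambda>x. a \<otimes> x) (carrier G)"
    using a(1) by (auto intro: inj_onI l_cancel)
  ultimately show "left_cancellable (power_semigroup G) A"
    using a by (auto simp: left_cancellable_def inj_on_image_eq_iff)
next
  assume cancellable: "left_cancellable (power_semigroup G) A"
  have "a = b" if ab: "a \<in> A" "b \<in> A" for a b
  proof (rule ccontr)
    assume "a \<noteq> b"
    have [simp]: "a \<in> carrier G" "b \<in> carrier G"
      using ab A by auto
    \<comment> \<open>Removing the single right factor \<open>a \<otimes> b\<close> will leave the
      product with A unchanged.\<close>
    let ?Y = "carrier G - {a \<otimes> b}"
    have "x \<otimes> (a \<otimes> b) \<in> A <#> ?Y" if x: "x \<in> A" for x
    proof -
      have [simp]: "x \<in> carrier G"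
        using x A by auto
      \<comment> \<open>The new left factor is \<open>b\<close> if \<open>x = a\<close>, and
        \<open>a\<close> otherwise. Duo brings it to the front: a a b = b z in the first case, x a b
        = a z b in the second.\<close>
      have "\<exists>y\<in>A. y \<noteq> x \<and> (\<exists>z\<in>carrier G. x \<otimes> (a \<otimes> b) = y \<otimes> z)"
      proof (cases "x = a")
        case True
        then show ?thesis
          using duo_monoidD[OF duo, of b "a \<otimes> a"] ab \<open>a \<noteq> b\<close> by (auto simp: m_assoc)
      next
        case False
        obtain z where "z \<in> carrier G" "x \<otimes> a = a \<otimes> z"
          using duo_monoidD[OF duo, of a x] by auto
        then have "x \<otimes> (a \<otimes> b) = a \<otimes> (z \<otimes> b)"
          by (simp flip: m_assoc)
        then show ?thesis
          using False ab(1) \<open>z \<in> carrier G\<close> by (metis \<open>b \<in> carrier G\<close> m_closed)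
      qed
      then obtain y z where yz: "y \<in> A" "y \<noteq> x" "z \<in> carrier G" "x \<otimes> (a \<otimes> b) = y \<otimes> z"
        by blast
      \<comment> \<open>Otherwise right cancellation would give \<open>x = y\<close>.\<close>
      moreover have "z \<noteq> a \<otimes> b"
        using yz A r_cancel[of x "a \<otimes> b" y] by auto
      ultimately show ?thesis
        by (auto simp: mem_set_mult_iff)
    qed
    then have "x \<otimes> y \<in> A <#> ?Y" if "x \<in> A" "y \<in> carrier G" for x y
      using that by (cases "y = a \<otimes> b") (auto simp: mem_set_mult_iff)
    then have "A <#> carrier G \<subseteq> A <#> ?Y"
      by (auto simp: mem_set_mult_iff[of _ G A "carrier G"])
    then have "A <#> carrier G = A <#> ?Y"
      by (simp add: set_mult_mono subset_antisym)
    \<comment> \<open>Non-empty: \<open>a\<close> and \<open>b\<close> are distinct, so at least one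
      of them differs from \<open>a \<otimes> b\<close>.\<close>
    moreover have "?Y \<in> carrier (power_semigroup G)"
      using \<open>a \<noteq> b\<close> \<open>a \<in> carrier G\<close> \<open>b \<in> carrier G\<close>
      by (metis DiffI Diff_subset empty_iff power_semigroup_simps(1) singletonD)
    moreover have "carrier G \<in> carrier (power_semigroup G)"
      by auto
    ultimately have "carrier G = ?Y"
      using cancellable unfolding left_cancellable_def power_semigroup_simps(2) by metis
    then show False
      using m_closed[OF \<open>a \<in> carrier G\<close> \<open>b \<in> carrier G\<close>] by blast
  qed
  moreover obtain a where a: "a \<in> A" "a \<in> carrier G"
    using A by auto
  ultimately have "A = {a}"
    by blast
  with a(2) show "\<exists>a\<in>carrier G. A = {a}"
    by blast
qed

text \<open>Left cancellability is invariant under isomorphism, so \<open>f\<close> matches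
  singletons with singletons. That images of singletons are singletons defines \<open>g\<close>;
  that preimages of singletons are singletons makes \<open>g\<close> surjective.\<close>

lemma power_iso_imp_iso:
  assumes H: "monoid_cancel H" "duo_monoid H" and K: "monoid_cancel K" "duo_monoid K"
    and f: "f \<in> iso (power_semigroup H) (power_semigroup K)"
  shows "H \<cong> K"
proof -
  interpret H: monoid_cancel H by fact
  interpret K: monoid_cancel K by fact
  have fhom: "f \<in> hom (power_semigroup H) (power_semigroup K)"
    and fim: "f ` carrier (power_semigroup H) = carrier (power_semigroup K)"
    and finj: "inj_on f (carrier (power_semigroup H))"
    using f by (auto simp: iso_iff)
  have sing_iff: "(\<exists>b\<in>carrier K. f X = {b}) \<longleftrightarrow> (\<exists>a\<in>carrier H. X = {a})"
    if X: "X \<in> carrier (power_semigroup H)" for X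
    using left_cancellable_iso_iff[OF monoid_power_semigroup[OF H.monoid_axioms] f X]
    unfolding H.left_cancellable_power_semigroup_iff[OF H(2) X]
      K.left_cancellable_power_semigroup_iff[OF K(2) hom_in_carrier[OF fhom X]] .
  have "\<exists>b\<in>carrier K. f {a} = {b}" if "a \<in> carrier H" for a
    using sing_iff[of "{a}"] that by auto
  then obtain g where g: "\<And>a. a \<in> carrier H \<Longrightarrow> g a \<in> carrier K"
    "\<And>a. a \<in> carrier H \<Longrightarrow> f {a} = {g a}"
    by metis
  have "g \<in> iso H K"
    unfolding iso_iff
  proof (intro conjI)
    show "g \<in> hom H K"
    proof (rule homI)
      fix a b assume ab: "a \<in> carrier H" "b \<in> carrier H"
      have "f ({a} <#>\<^bsub>H\<^esub> {b}) = f {a} <#>\<^bsub>K\<^esub> f {b}"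
        using hom_mult[OF fhom, of "{a}" "{b}"] ab by simp
      then show "g (a \<otimes>\<^bsub>H\<^esub> b) = g a \<otimes>\<^bsub>K\<^esub> g b"
        using g(2) ab by (simp add: set_mult_def)
    qed (rule g(1))
    show "inj_on g (carrier H)"
    proof (rule inj_onI)
      fix a b assume ab: "a \<in> carrier H" "b \<in> carrier H" "g a = g b"
      then have "f {a} = f {b}"
        by (simp add: g(2))
      then show "a = b"
        using inj_onD[OF finj, of "{a}" "{b}"] ab by simp
    qed
    show "g ` carrier H = carrier K"
    proof
      show "g ` carrier H \<subseteq> carrier K"
        using g(1) by blast
      show "carrier K \<subseteq> g ` carrier H"
      proof
        fix b assume b: "b \<in> carrier K"
        then have "{b} \<in> f ` carrier (power_semigroup H)"
          unfolding fim by simp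
        then obtain X where X: "X \<in> carrier (power_semigroup H)" "f X = {b}"
          by (metis imageE)
        then obtain a where "a \<in> carrier H" "X = {a}"
          using sing_iff b by blast
        then show "b \<in> g ` carrier H"
          using X(2) g(2) by auto
      qed
    qed
  qed
  then show ?thesis
    by (rule is_isoI)
qed

theorem theorem29:
  fixes H :: "('a, 'b) monoid_scheme" and K :: "('c, 'd) monoid_scheme"
  assumes "monoid_cancel H" "duo_monoid H" "strongly_archimedean H"
    and "monoid_cancel K" "duo_monoid K" "strongly_archimedean K"
    and "reduced_monoid H \<or> reduced_monoid K"
  shows "(\<forall>f \<in> iso (power_semigroup H) (power_semigroup K).
            f \<in> iso (ideal_semigroup H) (ideal_semigroup K) \<and>
            f ` carrier (ideal_semigroup H) = carrier (ideal_semigroup K)) \<and>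
         (power_semigroup H \<cong> power_semigroup K \<longrightarrow> H \<cong> K)"
proof (intro conjI ballI impI)
  have monoids: "monoid H" "monoid K"
    using assms(1,4) by (simp_all add: monoid_cancel_def)
  fix f assume f: "f \<in> iso (power_semigroup H) (power_semigroup K)"
  have "reduced_monoid H" "reduced_monoid K"
    using reduced_monoid_power_iso[OF monoids f] assms(7) by auto
  then have "f (carrier H) = carrier K"
    using power_iso_carrier[OF assms(1-3) _ assms(4-6) _ f] by blast
  then show "f \<in> iso (ideal_semigroup H) (ideal_semigroup K)"
    by (rule power_iso_imp_ideal_iso[OF monoids(1) assms(2) monoids(2) assms(5) f])
  then show "f ` carrier (ideal_semigroup H) = carrier (ideal_semigroup K)"
    by (simp add: iso_iff)
next
  assume "power_semigroup H \<cong> power_semigroup K"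
  \<comment> \<open>The isomorphism comes from the action on singletons, rather than on
    ideals.\<close>
  then show "H \<cong> K"
    using power_iso_imp_iso assms(1,2,4,5) by (auto simp: is_iso_def)
qed

end
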